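(* Let $G$ be a proof graph of a hypothesis $H$ of an abduction instance $(B,O,S)$ such that factoring in $G$ is only performed with atoms in $A(G)$. Let $P\in A(G)$ be an abduced atom, and let $Q_1,\dots,Q_k$ be the atoms that are factored with $P$. Then for an arbitrary $i$, $1\le i\le k$, one can swap $Q_i$ with $P$, i.e., factor $P$ with $Q_i$ and factor all other $Q_j$, $j\neq i$, with $Q_i$ (replacing the factoring edges $(P,Q_1),\dots,(P,Q_k)$ by the factoring edge $(Q_i,P)$ and the factoring edges $(Q_i,Q_j)$, $j\ne i$), and the values of all the objective functions $\mathrm{CARD}$, $\mathrm{COH}$ and $\mathrm{WA}$ stay the same.
   Context: **Abduction instances.** An abduction instance is a tuple $A=(B,O,S)$. Here $O$ (observation, goal) is an existentially quantified conjunction of atoms, also regarded as a set of atoms, whose existential variables are represented by constants not in $S$. $B$ is a finite set of axioms, each a single-head Horn clause $$q(Y_1,\dots,Y_m)\Leftarrow p_1(X^1_1,\dots,X^1_{k_1})\wedge\cdots\wedge p_r(X^r_1,\dots,X^r_{k_r}),$$ with all head variables occurring in the body, universally quantified (constants may also occur as arguments). $S$ is a set of constants of $B$ called sort names. $B$ is assumed acyclic: no circular inferences are possible over the axioms. **Hypotheses.** A hypothesis is a conjunction of atoms and equalities between terms. The set $\hat{\mathcal H}(A)$ of all hypotheses of $A$ is obtained from $\{O\}$ by closing under two operations. *Back-chaining*: given an atom $P$ in a hypothesis $H$ that unifies via $\theta$ with the head of an axiom, add the hypothesis $H\wedge P_1'\wedge\cdots\wedge P_r'$ with $P_i'=\theta(p_i(X^i_1,\dots,X^i_{k_i}))$,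 where body variables not in the head are existential and are replaced by Skolem terms (value invention). *Unification*: given distinct atoms $P,Q\in H$ unifying under $\theta$ such that all $X\mapsto Y\in\theta$ obey $X,Y\notin S$, add $H\wedge\bigwedge\{X=Y\mid X\mapsto Y\in\theta\}$. **Proof graphs.** A proof graph $G$ wrt. $H\in\hat{\mathcal H}(A)$ is an acyclic directed graph with nodes $N(G)=\{P\in H\mid P\text{ is not an equality}\}$ and edges $E(G)$ defined by the inference operations used to generate the atoms of $H$: back-chaining of $P$ induces an edge from each body atom $P_i'$ to $P$; unification of $P$ with $Q$ induces either an edge from $P$ to $Q$ or an edge from $Q$ to $P$. A unification edge $(P,Q)$ from $P$ to $Q$ is called a factoring edge, and we say that $Q$ is factored with $P$. Only hypotheses and proof graphs are considered where each atom is justified by a single inference (back-chaining), or by a single factoring, or not at all (then it is abduced). Let $A(G)=\{a\in N(G)\mid\nexists b:(b,a)\in E(G)\}$, the set of abduced atoms. Factoring is only performed with atoms in $A(G)$ if every factoring edge $(P,Q)$ has $P\in A(G)$. **Objective functions.** For a proof graph $G$: - $\mathrm{CARD}(G)=|A(G)|$ (cardinality). - $\mathrm{COH}(G)=|\{(a,b)\mid a,b\in O,\ a<b,\text{ and }\nexists n\in N(G)\text{ such that from }n\text{ we can reach both }a\text{ and }b\text{ in }G\}|$ (coherence), where $<$ is an arbitrary fixed total order on $O$. - $\mathrm{WA}(G)=\sum_{a\in A(G)}\min cost(a)$ (weighted abduction), where each axiom has weights $w_1,\dots,w_r$ for its body atoms, each $o\in O$ has an initial cost $ic(o)$, and $cost:N(G)\to2^{\mathbb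 R}$ is initialized with $\emptyset$ and recursively defined: (i) each $o\in O$ obtains $ic(o)$ as an element of $cost(o)$; (ii) if $P$ was back-chained with an axiom with body atoms $P_1',\dots,P_r'$ and $c=\min cost(P)$, then $c\cdot w_i$ is added to $cost(P_i')$ for $1\le i\le r$; (iii) if there is a factoring edge $(Q,P)$ from $Q$ to $P$, then $\min cost(P)$ is added to $cost(Q)$. *)

theory Defs
  imports Complex_Main
begin

text \<open>
  Predicate symbols, variables and constants have types \<open>'p\<close>, \<open>'v\<close>, \<open>'c\<close>.  Variables occur only in
  axioms; atoms of hypotheses are ground.  \<open>Skolem r x ts\<close> is the value invented for the variable
  \<open>x\<close> of the axiom \<open>r\<close> when an atom with arguments \<open>ts\<close> is back-chained with \<open>r\<close>.
\<close>

datatype ('p, 't) atom = Atom (pred: 'p) (args: "'t list")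

datatype ('v, 'c) arg = Var 'v | Con 'c

datatype ('p, 'v, 'c) axiom =
  Axiom (head: "('p, ('v, 'c) arg) atom") (body: "('p, ('v, 'c) arg) atom list")

datatype ('p, 'v, 'c) trm =
  Const 'c | Skolem "('p, 'v, 'c) axiom" 'v "('p, 'v, 'c) trm list"

type_synonym ('p, 'v, 'c) gatom = "('p, ('p, 'v, 'c) trm) atom"

definition vars :: "('p, ('v, 'c) arg) atom \<Rightarrow> 'v set" where
  "vars a = {x. Var x \<in> set (args a)}"

definition consts_of :: "('p, ('v, 'c) arg) atom \<Rightarrow> 'c set" where
  "consts_of a = {c. Con c \<in> set (args a)}"

primrec inst :: "('v \<Rightarrow> ('p, 'v, 'c) trm) \<Rightarrow> ('v, 'c) arg \<Rightarrow> ('p, 'v, 'c) trm" where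
  "inst \<theta> (Var x) = \<theta> x"
| "inst \<theta> (Con c) = Const c"

text \<open>
  \<open>backchain r P Ps\<close>: the atom \<open>P\<close> matches the head of \<open>r\<close>, and \<open>Ps\<close> are the resulting body atoms.
  The substitution, and hence \<open>Ps\<close>, is determined by \<open>r\<close> and \<open>P\<close>.
\<close>

definition backchain ::
  "('p, 'v, 'c) axiom \<Rightarrow> ('p, 'v, 'c) gatom \<Rightarrow> ('p, 'v, 'c) gatom list \<Rightarrow> bool" where
  "backchain r P Ps \<longleftrightarrow>
    (\<exists>\<theta>. map_atom id (inst \<theta>) (head r) = P \<and>
         (\<forall>x. x \<notin> vars (head r) \<longrightarrow> \<theta> x = Skolem r x (args P)) \<and>
         Ps = map (map_atom id (inst \<theta>)) (body r))"

record ('p, 'v, 'c) abduction =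
  base :: "('p, 'v, 'c) axiom set"
  goal :: "('p, 'v, 'c) gatom set"
  sorts :: "'c set"

text \<open>\<open>(r, r')\<close> is in \<open>feeds B\<close> iff an inference with \<open>r'\<close> can directly follow one with \<open>r\<close>.\<close>

definition feeds :: "('p, 'v, 'c) axiom set \<Rightarrow> ('p, 'v, 'c) axiom rel" where
  "feeds B = {(r, r'). r \<in> B \<and> r' \<in> B \<and>
    (\<exists>P Ps P' Ps'. backchain r P Ps \<and> P' \<in> set Ps \<and> backchain r' P' Ps')}"

definition abduction_instance :: "('p, 'v, 'c) abduction \<Rightarrow> bool" where
  "abduction_instance A \<longleftrightarrow>
    finite (base A) \<and> finite (goal A) \<and>
    (\<forall>r\<in>base A. body r \<noteq> [] \<and> vars (head r) \<subseteq> (\<Union>b\<in>set (body r). vars b)) \<and>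
    (\<forall>a\<in>goal A. set (args a) \<subseteq> range Const) \<and>
    sorts A \<subseteq> (\<Union>r\<in>base A. \<Union>b\<in>insert (head r) (set (body r)). consts_of b) \<and>
    acyclic (feeds (base A))"

text \<open>
  Unification of ground atoms.  Existential variables are represented by constants and Skolem terms,
  so every term plays the role of a variable and may be mapped to any other term; Skolem terms are
  not decomposed.  An idempotent most general unifier \<open>\<theta>\<close> is characterized by
  \<open>\<sigma> \<circ> \<theta> = \<sigma>\<close> for all unifiers \<open>\<sigma>\<close>.
\<close>

definition unifier :: "('t \<Rightarrow> 't) \<Rightarrow> ('p, 't) atom \<Rightarrow> ('p, 't) atom \<Rightarrow> bool" where
  "unifier \<sigma> P Q \<longleftrightarrow> map_atom id \<sigma> P = map_atom id \<sigma> Q"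

definition mgu :: "('t \<Rightarrow> 't) \<Rightarrow> ('p, 't) atom \<Rightarrow> ('p, 't) atom \<Rightarrow> bool" where
  "mgu \<theta> P Q \<longleftrightarrow> unifier \<theta> P Q \<and> (\<forall>\<sigma>. unifier \<sigma> P Q \<longrightarrow> \<sigma> \<circ> \<theta> = \<sigma>)"

definition mappings :: "('t \<Rightarrow> 't) \<Rightarrow> ('t \<times> 't) set" where
  "mappings \<theta> = {(X, \<theta> X) | X. \<theta> X \<noteq> X}"

definition unify ::
  "('p, 'v, 'c) abduction \<Rightarrow> (('p, 'v, 'c) trm \<Rightarrow> ('p, 'v, 'c) trm) \<Rightarrow>
   ('p, 'v, 'c) gatom \<Rightarrow> ('p, 'v, 'c) gatom \<Rightarrow> bool" where
  "unify A \<theta> P Q \<longleftrightarrow> P \<noteq> Q \<and> mgu \<theta> P Q \<and>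
    (\<forall>(X, Y)\<in>mappings \<theta>. X \<notin> Const ` sorts A \<and> Y \<notin> Const ` sorts A)"

record ('p, 'v, 'c) hypothesis =
  atoms :: "('p, 'v, 'c) gatom set"
  eqs :: "(('p, 'v, 'c) trm \<times> ('p, 'v, 'c) trm) set"

inductive_set hypotheses :: "('p, 'v, 'c) abduction \<Rightarrow> ('p, 'v, 'c) hypothesis set"
  for A :: "('p, 'v, 'c) abduction" where
  goal: "\<lparr>atoms = goal A, eqs = {}\<rparr> \<in> hypotheses A"
| back_chaining: "\<lbrakk>H \<in> hypotheses A; P \<in> atoms H; r \<in> base A; backchain r P Ps\<rbrakk>
    \<Longrightarrow> H\<lparr>atoms := atoms H \<union> set Ps\<rparr> \<in> hypotheses A"
| unification: "\<lbrakk>H \<in> hypotheses A; P \<in> atoms H; Q \<in> atoms H; unify A \<theta> P Q\<rbrakk>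
    \<Longrightarrow> H\<lparr>eqs := eqs H \<union> mappings \<theta>\<rparr> \<in> hypotheses A"

text \<open>
  Besides its factoring edges, a graph records which atom was back-chained with which axiom; the
  back-chaining edges are derived from this.
\<close>

record ('p, 'v, 'c) graph =
  nodes :: "('p, 'v, 'c) gatom set"
  chained :: "(('p, 'v, 'c) gatom \<times> ('p, 'v, 'c) axiom) set"
  factored :: "('p, 'v, 'c) gatom rel"

definition edges :: "('p, 'v, 'c) graph \<Rightarrow> ('p, 'v, 'c) gatom rel" where
  "edges G = {(P', P). \<exists>r Ps. (P, r) \<in> chained G \<and> backchain r P Ps \<and> P' \<in> set Ps} \<union> factored G"

text \<open>\<open>generates A H G\<close>: some sequence of operations generates \<open>H\<close> and induces the edges of \<open>G\<close>.\<close>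

inductive generates ::
  "('p, 'v, 'c) abduction \<Rightarrow> ('p, 'v, 'c) hypothesis \<Rightarrow> ('p, 'v, 'c) graph \<Rightarrow> bool"
  for A :: "('p, 'v, 'c) abduction" where
  goal: "generates A \<lparr>atoms = goal A, eqs = {}\<rparr> \<lparr>nodes = goal A, chained = {}, factored = {}\<rparr>"
| back_chaining: "\<lbrakk>generates A H G; P \<in> atoms H; r \<in> base A; backchain r P Ps\<rbrakk>
    \<Longrightarrow> generates A (H\<lparr>atoms := atoms H \<union> set Ps\<rparr>)
          (G\<lparr>nodes := nodes G \<union> set Ps, chained := insert (P, r) (chained G)\<rparr>)"
| unification: "\<lbrakk>generates A H G; P \<in> atoms H; Q \<in> atoms H; unify A \<theta> P Q; e \<in> {(P, Q), (Q, P)}\<rbrakk>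
    \<Longrightarrow> generates A (H\<lparr>eqs := eqs H \<union> mappings \<theta>\<rparr>) (G\<lparr>factored := insert e (factored G)\<rparr>)"

definition single_justification :: "('p, 'v, 'c) graph \<Rightarrow> bool" where
  "single_justification G \<longleftrightarrow> (\<forall>P.
    (\<forall>r r'. (P, r) \<in> chained G \<and> (P, r') \<in> chained G \<longrightarrow> r = r') \<and>
    (\<forall>Q Q'. (Q, P) \<in> factored G \<and> (Q', P) \<in> factored G \<longrightarrow> Q = Q') \<and>
    \<not> ((\<exists>r. (P, r) \<in> chained G) \<and> (\<exists>Q. (Q, P) \<in> factored G)))"

definition proof_graph ::
  "('p, 'v, 'c) abduction \<Rightarrow> ('p, 'v, 'c) hypothesis \<Rightarrow> ('p, 'v, 'c) graph \<Rightarrow> bool" where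
  "proof_graph A H G \<longleftrightarrow>
    H \<in> hypotheses A \<and> generates A H G \<and> acyclic (edges G) \<and> single_justification G"

definition abduced :: "('p, 'v, 'c) graph \<Rightarrow> ('p, 'v, 'c) gatom set" where
  "abduced G = {a \<in> nodes G. \<nexists>b. (b, a) \<in> edges G}"

definition factoring_only_with_abduced :: "('p, 'v, 'c) graph \<Rightarrow> bool" where
  "factoring_only_with_abduced G \<longleftrightarrow> (\<forall>(P, Q)\<in>factored G. P \<in> abduced G)"

definition CARD :: "('p, 'v, 'c) graph \<Rightarrow> nat" where
  "CARD G = card (abduced G)"

text \<open>Every node reaches itself: an atom of the goal may explain itself and another goal atom.\<close>

definition COH ::
  "('p, 'v, 'c) abduction \<Rightarrow> ('p, 'v, 'c) gatom rel \<Rightarrow> ('p, 'v, 'c) graph \<Rightarrow> nat" where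
  "COH A lt G = card {(a, b). a \<in> goal A \<and> b \<in> goal A \<and> (a, b) \<in> lt \<and>
    \<not> (\<exists>n\<in>nodes G. (n, a) \<in> (edges G)\<^sup>* \<and> (n, b) \<in> (edges G)\<^sup>*)}"

text \<open>
  \<open>w r j\<close> is the weight of the body atom of \<open>r\<close> with index \<open>j\<close>, counted from 0.  The cost of an atom
  depends only on the costs of its successors; the recursion is well-founded for finite acyclic
  graphs, where \<open>cost_unfold\<close> below holds.
\<close>

definition cost_step ::
  "('p, 'v, 'c) abduction \<Rightarrow> (('p, 'v, 'c) gatom \<Rightarrow> real) \<Rightarrow> (('p, 'v, 'c) axiom \<Rightarrow> nat \<Rightarrow> real) \<Rightarrow>
   ('p, 'v, 'c) graph \<Rightarrow> (('p, 'v, 'c) gatom \<Rightarrow> real set) \<Rightarrow> ('p, 'v, 'c) gatom \<Rightarrow> real set" where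
  "cost_step A ic w G f Q =
    (if Q \<in> goal A then {ic Q} else {}) \<union>
    {Min (f P) * w r j | P r Ps j.
       (P, r) \<in> chained G \<and> backchain r P Ps \<and> j < length Ps \<and> Ps ! j = Q} \<union>
    {Min (f P) | P. (Q, P) \<in> factored G}"

definition cost ::
  "('p, 'v, 'c) abduction \<Rightarrow> (('p, 'v, 'c) gatom \<Rightarrow> real) \<Rightarrow> (('p, 'v, 'c) axiom \<Rightarrow> nat \<Rightarrow> real) \<Rightarrow>
   ('p, 'v, 'c) graph \<Rightarrow> ('p, 'v, 'c) gatom \<Rightarrow> real set" where
  "cost A ic w G = wfrec ((edges G)\<inverse>) (cost_step A ic w G)"

definition WA ::
  "('p, 'v, 'c) abduction \<Rightarrow> (('p, 'v, 'c) gatom \<Rightarrow> real) \<Rightarrow> (('p, 'v, 'c) axiom \<Rightarrow> nat \<Rightarrow> real) \<Rightarrow>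
   ('p, 'v, 'c) graph \<Rightarrow> real" where
  "WA A ic w G = (\<Sum>a\<in>abduced G. Min (cost A ic w G a))"

definition swap ::
  "('p, 'v, 'c) graph \<Rightarrow> ('p, 'v, 'c) gatom \<Rightarrow> (nat \<Rightarrow> ('p, 'v, 'c) gatom) \<Rightarrow> nat \<Rightarrow> nat \<Rightarrow>
   ('p, 'v, 'c) graph" where
  "swap G P Q k i = G\<lparr>factored :=
    (factored G - {(P, Q j) | j. j \<in> {1..k}}) \<union> {(Q i, P)} \<union> {(Q i, Q j) | j. j \<in> {1..k} \<and> j \<noteq> i}\<rparr>"

lemma backchain_unique:
  assumes "backchain r P Ps" "backchain r P Ps'"
  shows "Ps = Ps'"
proof -
  obtain s where s: "map_atom id (inst s) (head r) = P"
    "\<forall>x. x \<notin> vars (head r) \<longrightarrow> s x = Skolem r x (args P)" "Ps = map (map_atom id (inst s)) (body r)"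
    using assms(1) unfolding backchain_def by blast
  obtain t where t: "map_atom id (inst t) (head r) = P"
    "\<forall>x. x \<notin> vars (head r) \<longrightarrow> t x = Skolem r x (args P)" "Ps' = map (map_atom id (inst t)) (body r)"
    using assms(2) unfolding backchain_def by blast
  have "map (inst s) (args (head r)) = map (inst t) (args (head r))"
    using s(1) t(1) by (metis atom.map_sel(2))
  then have "inst s a = inst t a" if "a \<in> set (args (head r))" for a
    using that by (meson map_eq_conv)
  then have "s x = t x" if "x \<in> vars (head r)" for x
    using that unfolding vars_def by force
  then have "s x = t x" for x using s(2) t(2) by metis
  then have "s = t" by (rule ext)
  then show ?thesis using s t by simp
qed

lemma generates_hypotheses: "generates A H G \<Longrightarrow> H \<in> hypotheses A \<and> nodes G = atoms H"
  by (induction rule: generates.induct) (auto intro: hypotheses.intros)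

lemma hypotheses_generates: "H \<in> hypotheses A \<Longrightarrow> \<exists>G. generates A H G"
  by (induction rule: hypotheses.induct) (blast intro: generates.intros)+

lemma generates_finite_edges:
  assumes "generates A H G"
  shows "finite (edges G)"
proof -
  have fin: "finite (chained G) \<and> finite (factored G)"
    using assms by (induction rule: generates.induct) auto
  have "edges G \<subseteq>
    (\<Union>(P, r)\<in>chained G. set (THE Ps. backchain r P Ps) \<times> {P}) \<union> factored G"
  proof
    fix e assume e: "e \<in> edges G"
    show "e \<in> (\<Union>(P, r)\<in>chained G. set (THE Ps. backchain r P Ps) \<times> {P}) \<union> factored G"
    proof (cases "e \<in> factored G")
      case False
      then obtain P' P r Ps where *: "e = (P', P)" "(P, r) \<in> chained G" "backchain r P Ps" "P' \<in> set Ps"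
        using e unfolding edges_def by blast
      have "(THE Ps. backchain r P Ps) = Ps"
        using * backchain_unique by blast
      then show ?thesis using * by force
    qed simp
  qed
  then show ?thesis by (rule finite_subset) (use fin in auto)
qed

lemma cost_unfold:
  assumes "proof_graph A H G"
  shows "cost A ic w G Q = cost_step A ic w G (cost A ic w G) Q"
proof -
  have wf: "wf ((edges G)\<inverse>)"
    using assms finite_acyclic_wf_converse generates_finite_edges unfolding proof_graph_def by blast
  have 1: "(P, Q) \<in> (edges G)\<inverse>"
    if "(P, r) \<in> chained G \<and> backchain r P Ps \<and> j < length Ps \<and> Ps ! j = Q" for P r Ps j
    using that unfolding edges_def by fastforce
  have 2: "(P, Q) \<in> (edges G)\<inverse>" if "(Q, P) \<in> factored G" for P
    using that unfolding edges_def by blast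
  have c: "cut f ((edges G)\<inverse>) Q P = f P" if "(P, Q) \<in> (edges G)\<inverse>"
    for P and f :: "('a, 'b, 'c) gatom \<Rightarrow> real set"
    using that by (rule cut_apply)
  have cong: "cost_step A ic w G (cut f ((edges G)\<inverse>) Q) Q = cost_step A ic w G f Q" for f
  proof -
    have "{Min (cut f ((edges G)\<inverse>) Q P) * w r j | P r Ps j.
        (P, r) \<in> chained G \<and> backchain r P Ps \<and> j < length Ps \<and> Ps ! j = Q} =
      {Min (f P) * w r j | P r Ps j.
        (P, r) \<in> chained G \<and> backchain r P Ps \<and> j < length Ps \<and> Ps ! j = Q}"
      using c[OF 1] by (intro Collect_cong iff_exI rev_conj_cong refl) simp
    moreover have "{Min (cut f ((edges G)\<inverse>) Q P) | P. (Q, P) \<in> factored G} =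
      {Min (f P) | P. (Q, P) \<in> factored G}"
      using c[OF 2] by (intro Collect_cong iff_exI rev_conj_cong refl) simp
    ultimately show ?thesis unfolding cost_step_def by (simp only:)
  qed
  show ?thesis unfolding cost_def using cong wfrec[OF wf, of "cost_step A ic w G" Q] by simp
qed

end

theory Submission
  imports Defs
begin

text \<open>
  Since \<open>P\<close> is abduced and each \<open>Q\<^sub>j\<close> is justified only by its factoring edge, no atom other than
  \<open>P\<close> and \<open>Q\<^sub>i\<close> changes its outgoing edges, and nothing outside this group depends on them:
  \<open>Q\<^sub>i\<close> takes over the position of \<open>P\<close> as the unique source.  Its cost after the swap and the
  cost of \<open>P\<close> before it are both the minimum of the costs that \<open>P\<close> and the \<open>Q\<^sub>j\<close> have without
  factoring.  The new factoring edges are legal because unifiability respecting sort names is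
  a positionwise equivalence relation on atoms.
\<close>

section \<open>Unifiability as a positionwise relation\<close>

text \<open>A unifier obeying the restriction moves neither from nor to a sort name, so two
  different terms with a common image are both not sort names. Conversely, choosing one
  representative in each class of the equivalence generated by the argument pairs gives an mgu. The
  positionwise form makes symmetry and transitivity easy to read off.\<close>

lemma unifiable_iff:
  "(\<exists>\<theta>. unify A \<theta> P Q) \<longleftrightarrow> P \<noteq> Q \<and> pred P = pred Q \<and>
    list_all2 (\<lambda>x y. x = y \<or> x \<notin> Const ` sorts A \<and> y \<notin> Const ` sorts A) (args P) (args Q)"
    (is "?L \<longleftrightarrow> ?R")
proof
  assume ?L
  then obtain \<theta> where \<theta>: "unify A \<theta> P Q" ..
  then have ne: "P \<noteq> Q" and u: "map_atom id \<theta> P = map_atom id \<theta> Q"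
    unfolding unify_def mgu_def unifier_def by simp_all
  have s: "X \<notin> Const ` sorts A \<and> \<theta> X \<notin> Const ` sorts A" if "\<theta> X \<noteq> X" for X
  proof -
    have "(X, \<theta> X) \<in> mappings \<theta>" using that unfolding mappings_def by simp
    then show ?thesis using \<theta> unfolding unify_def by blast
  qed
  have p: "pred P = pred Q"
    using arg_cong[OF u, of pred] by (simp add: atom.map_sel)
  have m: "map \<theta> (args P) = map \<theta> (args Q)"
    using arg_cong[OF u, of args] by (simp add: atom.map_sel)
  have "x = y \<or> x \<notin> Const ` sorts A \<and> y \<notin> Const ` sorts A" if "\<theta> x = \<theta> y" for x y
    using s[of x] s[of y] that by (cases "\<theta> x = x"; cases "\<theta> y = y") simp_all
  moreover have "list_all2 (\<lambda>x y. \<theta> x = \<theta> y) (args P) (args Q)"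
    using m by (simp add: list_all2_conv_all_nth list_eq_iff_nth_eq)
  ultimately have "list_all2 (\<lambda>x y. x = y \<or> x \<notin> Const ` sorts A \<and> y \<notin> Const ` sorts A) (args P) (args Q)"
    by (rule list_all2_mono[rotated])
  then show ?R using ne p by simp
next
  assume R: ?R
  define D where "D = set (zip (args P) (args Q))"
  define E where "E = (D \<union> D\<inverse>)\<^sup>*"
  \<comment> \<open>\<open>E\<close> is the equivalence closure of the argument pairs. The choice
    depends only on the class of \<open>X\<close>, so equivalent terms get the same
    representative.\<close>
  define \<theta> where "\<theta> X = (SOME Y. (X, Y) \<in> E)" for X
  have len: "length (args P) = length (args Q)"
    using R by (auto dest: list_all2_lengthD)
  have "sym E" unfolding E_def by (intro sym_rtrancl) (auto simp: sym_def)
  have "trans E" unfolding E_def by (rule trans_rtrancl)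
  have class_eq: "(x, z) \<in> E \<longleftrightarrow> (y, z) \<in> E" if "(x, y) \<in> E" for x y z
    using symD[OF \<open>sym E\<close> that] transD[OF \<open>trans E\<close>] that by blast
  have \<theta>_eq: "\<theta> x = \<theta> y" if "(x, y) \<in> E" for x y
    using class_eq[OF that] unfolding \<theta>_def by simp
  have \<theta>_in: "(X, \<theta> X) \<in> E" for X
    unfolding \<theta>_def by (rule someI[of _ X]) (simp add: E_def)
  have "\<theta> (args P ! j) = \<theta> (args Q ! j)" if "j < length (args P)" for j
  proof (rule \<theta>_eq)
    have "(args P ! j, args Q ! j) \<in> D"
      using that len by (auto simp: D_def set_zip)
    then show "(args P ! j, args Q ! j) \<in> E" unfolding E_def by blast
  qed
  then have "map \<theta> (args P) = map \<theta> (args Q)"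
    using len by (simp add: list_eq_iff_nth_eq)
  then have "unifier \<theta> P Q"
    using R unfolding unifier_def by (intro atom.expand conjI) (simp_all add: atom.map_sel)
  \<comment> \<open>Every unifier is constant on the classes of \<open>E\<close>, and \<theta> never
    leaves a class.\<close>
  moreover have "\<sigma> \<circ> \<theta> = \<sigma>" if "unifier \<sigma> P Q" for \<sigma>
  proof -
    have "map \<sigma> (args P) = map \<sigma> (args Q)"
      using arg_cong[OF that[unfolded unifier_def], of args] by (simp add: atom.map_sel)
    then have D: "\<sigma> x = \<sigma> y" if "(x, y) \<in> D" for x y
      using that by (auto simp: D_def set_zip list_eq_iff_nth_eq)
    have "\<sigma> x = \<sigma> y" if "(x, y) \<in> E" for x y
      using that unfolding E_def by (induction rule: rtrancl_induct) (use D in auto)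
    from this[OF \<theta>_in, symmetric] show ?thesis by (intro ext) simp
  qed
  \<comment> \<open>Each nontrivial link of a chain joins two terms that are not sort names, so this
    holds for the ends of the chain as well.\<close>
  moreover have sort: "X = Y \<or> X \<notin> Const ` sorts A \<and> Y \<notin> Const ` sorts A" if "(X, Y) \<in> E" for X Y
    using that unfolding E_def
  proof (induction rule: rtrancl_induct)
    case (step y z)
    have "y = z \<or> y \<notin> Const ` sorts A \<and> z \<notin> Const ` sorts A"
      using step(2) R by (auto simp: D_def list_all2_iff)
    then show ?case using step.IH by blast
  qed simp
  moreover have "X \<notin> Const ` sorts A \<and> Y \<notin> Const ` sorts A" if "(X, Y) \<in> mappings \<theta>" for X Y
    using sort[OF \<theta>_in[of X]] that unfolding mappings_def by auto
  ultimately have "unify A \<theta> P Q"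
    using R unfolding unify_def mgu_def by blast
  then show ?L by blast
qed

lemma unifiable_sym: "(\<exists>\<theta>. unify A \<theta> P Q) \<Longrightarrow> \<exists>\<theta>. unify A \<theta> Q P"
  unfolding unifiable_iff by (auto simp: list_all2_conv_all_nth)

lemma unifiable_trans:
  "\<lbrakk>\<exists>\<theta>. unify A \<theta> P Q; \<exists>\<theta>. unify A \<theta> Q R; P \<noteq> R\<rbrakk> \<Longrightarrow> \<exists>\<theta>. unify A \<theta> P R"
  unfolding unifiable_iff by (fastforce simp: list_all2_conv_all_nth)

section \<open>Derivations of graphs and changes to their factoring edges\<close>

lemma generates_factored:
  "generates A H G \<Longrightarrow> (P, Q) \<in> factored G \<Longrightarrow>
    P \<in> nodes G \<and> Q \<in> nodes G \<and> (\<exists>\<theta>. unify A \<theta> P Q)"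
proof (induction rule: generates.induct)
  case (unification H G R S \<theta> e)
  then show ?case
    using generates_hypotheses[OF unification(1)] unifiable_sym[of A R S] by auto
qed auto

lemma generates_chained:
  "generates A H G \<Longrightarrow> (P, r) \<in> chained G \<Longrightarrow> r \<in> base A \<and> (\<exists>Ps. backchain r P Ps)"
  by (induction rule: generates.induct) auto

lemma generates_finite_chained: "generates A H G \<Longrightarrow> finite (chained G)"
  by (induction rule: generates.induct) auto

lemma generates_finite_nodes: "generates A H G \<Longrightarrow> finite (goal A) \<Longrightarrow> finite (nodes G)"
  by (induction rule: generates.induct) auto

text \<open>Unification introduces no atoms. This ensures that every node has a cost independent of
  factoring, so that \<open>Min\<close> is taken over a nonempty set.\<close>

lemma generates_node_origin:
  "generates A H G \<Longrightarrow> R \<in> nodes G \<Longrightarrow>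
    R \<in> goal A \<or> (\<exists>P r Ps. (P, r) \<in> chained G \<and> backchain r P Ps \<and> R \<in> set Ps)"
  by (induction rule: generates.induct) (simp, (auto; blast)+)

text \<open>Unification adds only equations, so a step whose edge is unwanted can be skipped without
  disabling later steps. Equations may be lost, hence only the atoms are claimed to agree.\<close>

lemma generates_restrict_factored:
  "\<lbrakk>generates A H G; F \<subseteq> factored G\<rbrakk>
    \<Longrightarrow> \<exists>H'. generates A H' (G\<lparr>factored := F\<rparr>) \<and> atoms H' = atoms H"
proof (induction arbitrary: F rule: generates.induct)
  case goal
  then show ?case using generates.goal[of A] by auto
next
  case (back_chaining H G P r Ps)
  then have "F \<subseteq> factored G" by simp
  then obtain H' where "generates A H' (G\<lparr>factored := F\<rparr>)" "atoms H' = atoms H"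
    using back_chaining.IH by blast
  then show ?case
    using generates.back_chaining[of A H' "G\<lparr>factored := F\<rparr>" P r Ps] back_chaining
    by (cases G) (intro exI[of _ "H'\<lparr>atoms := atoms H' \<union> set Ps\<rparr>"], simp)
next
  case (unification H G P Q \<theta> e)
  \<comment> \<open>The edge \<open>e\<close> may have been present before this step; taking it out
    of \<open>F\<close> yields a subset of the earlier edges in any case.\<close>
  obtain H' where H': "generates A H' (G\<lparr>factored := F - {e}\<rparr>)" "atoms H' = atoms H"
    using unification.IH[of "F - {e}"] unification.prems by auto
  show ?case
  proof (cases "e \<in> F")
    case True
    then show ?thesis
      using generates.unification[OF H'(1), of P Q \<theta> e] unification H'(2)
      by (intro exI[of _ "H'\<lparr>eqs := eqs H' \<union> mappings \<theta>\<rparr>"]) (simp add: insert_absorb)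
  qed (use H' in auto)
qed

lemma generates_add_factored:
  assumes "finite F" "generates A H G"
    "\<forall>(P, Q)\<in>F. P \<in> nodes G \<and> Q \<in> nodes G \<and> (\<exists>\<theta>. unify A \<theta> P Q)"
  shows "\<exists>H'. generates A H' (G\<lparr>factored := factored G \<union> F\<rparr>) \<and> atoms H' = atoms H"
  using assms
proof (induction rule: finite_induct)
  case empty
  then show ?case by auto
next
  case (insert e F)
  then obtain H' where H': "generates A H' (G\<lparr>factored := factored G \<union> F\<rparr>)" "atoms H' = atoms H"
    by auto
  obtain P Q \<theta> where e: "e = (P, Q)" "P \<in> nodes G" "Q \<in> nodes G" "unify A \<theta> P Q"
    using insert.prems by auto
  then show ?case
    using generates.unification[OF H'(1), of P Q \<theta> e] H'(2) generates_hypotheses[OF insert.prems(1)]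
    by (intro exI[of _ "H'\<lparr>eqs := eqs H' \<union> mappings \<theta>\<rparr>"]) simp
qed

section \<open>Costs without factoring\<close>

text \<open>Both sides are the minimum of \<open>U \<union> V \<union> M\<close>. In the application
  \<open>U\<close> and \<open>V\<close> are the unfactored costs of the two swapped atoms, and
  \<open>M\<close> holds the costs of the other factored atoms.\<close>

lemma Min_Un_insert_Min:
  fixes U V M :: "'a :: linorder set"
  assumes "finite U" "finite V" "finite M" "U \<noteq> {}" "V \<noteq> {}"
  shows "Min (U \<union> insert (Min V) M) = Min (V \<union> insert (Min U) M)"
\<comment> \<open>\<open>M\<close> is empty if only one atom is factored with \<open>P\<close>;
  \<open>Min\<close> of the empty set is unspecified.\<close>
proof (cases "M = {}")
  case True
  then show ?thesis using assms by (simp add: min.commute)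
next
  case False
  then show ?thesis using assms by (simp add: Min_Un min.left_commute)
qed

text \<open>This isolates the part of the cost recursion that depends on the graph only through
  \<open>chained\<close>, which the swap leaves alone.\<close>

definition unfactored_cost ::
  "('p, 'v, 'c) abduction \<Rightarrow> (('p, 'v, 'c) gatom \<Rightarrow> real) \<Rightarrow> (('p, 'v, 'c) axiom \<Rightarrow> nat \<Rightarrow> real) \<Rightarrow>
   ('p, 'v, 'c) graph \<Rightarrow> (('p, 'v, 'c) gatom \<Rightarrow> real set) \<Rightarrow> ('p, 'v, 'c) gatom \<Rightarrow> real set" where
  "unfactored_cost A ic w G f Q =
    (if Q \<in> goal A then {ic Q} else {}) \<union>
    {Min (f P) * w r j | P r Ps j.
       (P, r) \<in> chained G \<and> backchain r P Ps \<and> j < length Ps \<and> Ps ! j = Q}"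

lemma cost_step_unfactored:
  "cost_step A ic w G f Q = unfactored_cost A ic w G f Q \<union> (\<lambda>P. Min (f P)) ` {P. (Q, P) \<in> factored G}"
  unfolding cost_step_def unfactored_cost_def by auto

lemma finite_unfactored_cost:
  assumes "finite (chained G)"
  shows "finite (unfactored_cost A ic w G f Q)"
proof -
  have "{Min (f P) * w r j | P r Ps j.
       (P, r) \<in> chained G \<and> backchain r P Ps \<and> j < length Ps \<and> Ps ! j = Q}
    \<subseteq> (\<Union>(P, r)\<in>chained G. (\<lambda>j. Min (f P) * w r j) ` {..<length (body r)})"
    unfolding backchain_def by fastforce
  then have "finite {Min (f P) * w r j | P r Ps j.
       (P, r) \<in> chained G \<and> backchain r P Ps \<and> j < length Ps \<and> Ps ! j = Q}"
    by (rule finite_subset) (use assms in auto)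
  then show ?thesis unfolding unfactored_cost_def by simp
qed

lemma unfactored_cost_nonempty:
  assumes "generates A H G" "Q \<in> nodes G"
  shows "unfactored_cost A ic w G f Q \<noteq> {}"
  using generates_node_origin[OF assms] unfolding unfactored_cost_def in_set_conv_nth
  by (auto; blast)

lemma unfactored_cost_cong:
  assumes "\<And>P. (Q, P) \<in> edges G \<Longrightarrow> f P = g P" "chained G' = chained G"
  shows "unfactored_cost A ic w G' f Q = unfactored_cost A ic w G g Q"
proof -
  have "f P = g P" if "(P, r) \<in> chained G" "backchain r P Ps" "j < length Ps" "Ps ! j = Q" for P r Ps j
    using that by (intro assms(1)) (auto simp: edges_def in_set_conv_nth)
  then show ?thesis
    unfolding unfactored_cost_def assms(2)
    by (intro arg_cong2[of _ _ _ _ "(\<union>)"] refl Collect_cong iff_exI rev_conj_cong) auto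
qed

section \<open>The neighbourhood of the swapped atoms\<close>

locale factored_group =
  fixes A :: "('p, 'v, 'c) abduction" and H :: "('p, 'v, 'c) hypothesis"
    and G :: "('p, 'v, 'c) graph" and P q :: "('p, 'v, 'c) gatom"
  assumes inst: "abduction_instance A"
    and pg: "proof_graph A H G"
    and only_abduced: "factoring_only_with_abduced G"
    and P_abduced: "P \<in> abduced G"
    and q_factored: "(P, q) \<in> factored G"
begin

definition group :: "('p, 'v, 'c) gatom set" where
  "group = {R. (P, R) \<in> factored G}"

text \<open>The swap depends only on the set of atoms factored with \<open>P\<close> and on the atom
  \<open>q\<close> taking over, so indices are avoided until the end.\<close>

definition G' :: "('p, 'v, 'c) graph" where
  "G' = G\<lparr>factored := (factored G - {P} \<times> group) \<union> {q} \<times> (insert P group - {q})\<rparr>"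

lemma chained_G': "chained G' = chained G"
  by (simp add: G'_def)

lemma gen: "generates A H G"
  using pg by (simp add: proof_graph_def)

lemma acyc: "acyclic (edges G)"
  using pg by (simp add: proof_graph_def)

lemma no_edge_to_P: "(R, P) \<notin> edges G"
  using P_abduced by (simp add: abduced_def)

lemma q_group: "q \<in> group"
  using q_factored by (simp add: group_def)

lemma group_not_chained: "R \<in> group \<Longrightarrow> (R, r) \<notin> chained G"
  using pg unfolding group_def proof_graph_def single_justification_def by blast

text \<open>Axiom bodies are nonempty, so back-chaining \<open>P\<close> would create an edge into
  the abduced atom \<open>P\<close>.\<close>

lemma P_not_chained: "(P, r) \<notin> chained G"
proof
  assume c: "(P, r) \<in> chained G"
  then obtain Ps where "r \<in> base A" "backchain r P Ps"
    using generates_chained[OF gen] by blast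
  then have "backchain r P Ps" "Ps \<noteq> []"
    using inst unfolding abduction_instance_def backchain_def by auto
  then have "(hd Ps, P) \<in> edges G"
    using c unfolding edges_def by fastforce
  then show False using no_edge_to_P by blast
qed

text \<open>The factoring edge from \<open>P\<close> is the single justification of a group atom; it
  excludes back-chaining and any other factoring edge into it.\<close>

lemma edge_to_group: "R \<in> group \<Longrightarrow> (S, R) \<in> edges G \<longleftrightarrow> S = P"
  using pg group_not_chained[of R]
  unfolding edges_def group_def proof_graph_def single_justification_def by blast

lemma P_notin_group: "P \<notin> group"
  using edge_to_group[of P] no_edge_to_P by blast

text \<open>Factoring edges start at abduced atoms, but a group atom has an incoming edge from
  \<open>P\<close>.\<close>

lemma group_not_factored: "R \<in> group \<Longrightarrow> (R, S) \<notin> factored G"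
  using only_abduced edge_to_group[of R]
  unfolding factoring_only_with_abduced_def abduced_def by blast

lemma group_nodes: "insert P group \<subseteq> nodes G"
  using generates_factored[OF gen] P_abduced unfolding group_def abduced_def by blast

text \<open>Group atoms are not back-chained, so no back-chaining edge duplicates a removed
  factoring edge.\<close>

lemma edges_G': "edges G' = (edges G - {P} \<times> group) \<union> {q} \<times> (insert P group - {q})"
proof -
  have "(P, R) \<notin> {(P', P). \<exists>r Ps. (P, r) \<in> chained G \<and> backchain r P Ps \<and> P' \<in> set Ps}"
    if "R \<in> group" for R
    using group_not_chained[OF that] by blast
  then show ?thesis unfolding edges_def G'_def by auto
qed

lemma no_edge_to_q: "(R, q) \<notin> edges G'"
  using edge_to_group[OF q_group] P_notin_group q_group unfolding edges_G' by auto

text \<open>Incoming edges change only within \<open>insert P group\<close>: \<open>q\<close> loses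
  its only one, \<open>P\<close> gains one, and the others now have theirs from
  \<open>q\<close>.\<close>

lemma abduced_G': "abduced G' = insert q (abduced G - {P})"
proof -
  have n: "nodes G' = nodes G" by (simp add: G'_def)
  have "R \<in> abduced G' \<longleftrightarrow> R \<in> insert q (abduced G - {P})" for R
  proof -
    consider "R = q" | "R = P" | "R \<in> group" "R \<noteq> q" | "R \<noteq> P" "R \<notin> group" "R \<noteq> q" by blast
    then show ?thesis
    proof cases
      case 1
      then show ?thesis using no_edge_to_q group_nodes q_group n unfolding abduced_def by auto
    next
      case 2
      then have "(q, R) \<in> edges G'" using P_notin_group q_group unfolding edges_G' by auto
      then show ?thesis using 2 P_notin_group q_group unfolding abduced_def by auto
    next
      case 3
      then have "(q, R) \<in> edges G'" "(P, R) \<in> edges G"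
        using edge_to_group unfolding edges_G' by auto
      then show ?thesis using 3 unfolding abduced_def by blast
    next
      case 4
      then have "(S, R) \<in> edges G' \<longleftrightarrow> (S, R) \<in> edges G" for S unfolding edges_G' by auto
      then show ?thesis using 4 n unfolding abduced_def by simp
    qed
  qed
  then show ?thesis by blast
qed

lemma q_notin_abduced: "q \<notin> abduced G"
  using edge_to_group[OF q_group] unfolding abduced_def by blast

lemma finite_abduced: "finite (abduced G)"
  using generates_finite_nodes[OF gen] inst unfolding abduction_instance_def abduced_def by auto

section \<open>The swapped graph is a proof graph\<close>

text \<open>The edges out of \<open>P\<close> into the group are dropped from the derivation and the
  new ones are appended by further unifications. These are legal since \<open>q\<close> and every
  other group atom unify with \<open>P\<close>, hence with each other.\<close>

lemma generates_G': "\<exists>H'. generates A H' G' \<and> atoms H' = atoms H"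
proof -
  obtain H1 where H1: "generates A H1 (G\<lparr>factored := factored G - {P} \<times> group\<rparr>)" "atoms H1 = atoms H"
    using generates_restrict_factored[OF gen, of "factored G - {P} \<times> group"] by auto
  have unif: "\<exists>\<theta>. unify A \<theta> P R" if "R \<in> group" for R
    using generates_factored[OF gen] that unfolding group_def by blast
  have "\<exists>\<theta>. unify A \<theta> q R" if "R \<in> insert P group - {q}" for R
  proof (cases "R = P")
    case True
    then show ?thesis using unifiable_sym[OF unif[OF q_group]] by simp
  next
    case False
    then show ?thesis
      using unifiable_trans[OF unifiable_sym[OF unif[OF q_group]] unif[of R]] that by auto
  qed
  moreover have "finite (insert P group)"
    using group_nodes generates_finite_nodes[OF gen] inst
    unfolding abduction_instance_def by (meson finite_subset)
  ultimately obtain H' where "generates A H' (G\<lparr>factored := factored G - {P} \<times> group,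
      factored := (factored G - {P} \<times> group) \<union> {q} \<times> (insert P group - {q})\<rparr>)" "atoms H' = atoms H1"
    using generates_add_factored[OF _ H1(1), of "{q} \<times> (insert P group - {q})"]
      group_nodes q_group by auto
  then show ?thesis using H1(2) unfolding G'_def by auto
qed

text \<open>No edge enters \<open>q\<close>, so \<open>q\<close> lies on no cycle, and a path
  starting elsewhere avoids \<open>q\<close> and uses only edges of \<open>G\<close>.\<close>

lemma acyclic_G': "acyclic (edges G')"
proof -
  have "(x, y) \<in> (edges G)\<^sup>+" if "(x, y) \<in> (edges G')\<^sup>+" "x \<noteq> q" for x y
    using that
  proof (induction rule: trancl_induct)
    case (base y)
    then show ?case unfolding edges_G' by auto
  next
    case (step y z)
    have "y \<noteq> q" using step(1) no_edge_to_q by (metis tranclE)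
    then show ?case using step unfolding edges_G' by (auto intro: trancl_into_trancl)
  qed
  moreover have "(q, q) \<notin> (edges G')\<^sup>+" using no_edge_to_q by (metis tranclE)
  ultimately show ?thesis using acyc unfolding acyclic_def by metis
qed

lemma single_justification_G': "single_justification G'"
proof -
  have sj: "single_justification G" using pg by (simp add: proof_graph_def)
  have new: "(S, R) \<in> factored G' \<longleftrightarrow> S = q \<and> R \<noteq> q" if "R \<in> insert P group" for R S
    using that no_edge_to_P edge_to_group[of R] unfolding G'_def edges_def by auto
  have old: "(S, R) \<in> factored G' \<longleftrightarrow> (S, R) \<in> factored G" if "R \<notin> insert P group" for R S
    using that unfolding G'_def by auto
  have nch: "(R, r) \<notin> chained G" if "R \<in> insert P group" for R r
    using that P_not_chained group_not_chained by auto
  show ?thesis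
    unfolding single_justification_def
  proof (rule allI)
    fix R
    show "(\<forall>r r'. (R, r) \<in> chained G' \<and> (R, r') \<in> chained G' \<longrightarrow> r = r') \<and>
      (\<forall>Q Q'. (Q, R) \<in> factored G' \<and> (Q', R) \<in> factored G' \<longrightarrow> Q = Q') \<and>
      \<not> ((\<exists>r. (R, r) \<in> chained G') \<and> (\<exists>Q. (Q, R) \<in> factored G'))"
    proof (cases "R \<in> insert P group")
      case True
      then show ?thesis using nch new unfolding chained_G' by simp
    next
      case False
      then show ?thesis using sj unfolding chained_G' old[OF False] single_justification_def by blast
    qed
  qed
qed

lemma proof_graph_G': "\<exists>H'. proof_graph A H' G' \<and> atoms H' = atoms H"
  using generates_G' generates_hypotheses acyclic_G' single_justification_G'
  unfolding proof_graph_def by blast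

section \<open>Cardinality and coherence\<close>

lemma CARD_G': "CARD G' = CARD G"
proof -
  have "CARD G' = Suc (card (abduced G - {P}))"
    using finite_abduced q_notin_abduced unfolding CARD_def abduced_G' by simp
  also have "\<dots> = CARD G"
    unfolding CARD_def by (rule card_Suc_Diff1[OF finite_abduced P_abduced])
  finally show ?thesis .
qed

text \<open>A common ancestor survives if \<open>P\<close> and \<open>q\<close> are exchanged as
  sources: in \<open>G\<close>, \<open>P\<close> reaches all that \<open>q\<close> reaches, and in
  \<open>G'\<close> the converse holds. Other starting nodes can be kept.\<close>

lemma reach_G'_iff:
  "(\<exists>n\<in>nodes G'. (n, a) \<in> (edges G')\<^sup>* \<and> (n, b) \<in> (edges G')\<^sup>*) \<longleftrightarrow>
   (\<exists>n\<in>nodes G. (n, a) \<in> (edges G)\<^sup>* \<and> (n, b) \<in> (edges G)\<^sup>*)"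
proof -
  have n: "nodes G' = nodes G" by (simp add: G'_def)
  have to_G: "(if x = q then P else x, y) \<in> (edges G)\<^sup>*" if "(x, y) \<in> (edges G')\<^sup>*" for x y
    using that
  proof (induction rule: rtrancl_induct)
    case base
    then show ?case using edge_to_group[OF q_group] by auto
  next
    case (step y z)
    show ?case
    proof (cases "y = q")
      case True
      \<comment> \<open>A source can occur on a path only as its first node.\<close>
      then have "x = q" using step(1) no_edge_to_q by (metis rtranclE)
      moreover have "(P, z) \<in> (edges G)\<^sup>*"
      proof -
        have "(P, q) \<in> edges G" using edge_to_group[OF q_group] by simp
        moreover have "(q, z) \<in> edges G \<or> z = P \<or> (P, z) \<in> edges G"
          using step(2) True edge_to_group[of z] unfolding edges_G' by auto
        ultimately show ?thesis by auto
      qed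
      ultimately show ?thesis by simp
    next
      case False
      then have "(y, z) \<in> edges G" using step(2) unfolding edges_G' by auto
      then show ?thesis using step.IH by (rule rtrancl_into_rtrancl[rotated])
    qed
  qed
  have to_G': "(if x = P then q else x, y) \<in> (edges G')\<^sup>*" if "(x, y) \<in> (edges G)\<^sup>*" for x y
    using that
  proof (induction rule: rtrancl_induct)
    case base
    have "(q, P) \<in> edges G'" using P_notin_group q_group unfolding edges_G' by auto
    then show ?case by auto
  next
    case (step y z)
    show ?case
    proof (cases "y = P \<and> z \<in> group")
      case True
      then have "x = P" using step(1) no_edge_to_P by (metis rtranclE)
      moreover have "(q, z) \<in> (edges G')\<^sup>*"
        using True unfolding edges_G' by (cases "z = q") auto
      ultimately show ?thesis by simp
    next
      case False
      then have "(y, z) \<in> edges G'" using step(2) unfolding edges_G' by auto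
      then show ?thesis using step.IH by (rule rtrancl_into_rtrancl[rotated])
    qed
  qed
  have P: "P \<in> nodes G" and q: "q \<in> nodes G" using group_nodes q_group by auto
  show ?thesis
    unfolding n
  proof
    assume "\<exists>n\<in>nodes G. (n, a) \<in> (edges G')\<^sup>* \<and> (n, b) \<in> (edges G')\<^sup>*"
    then obtain n where "n \<in> nodes G" "(n, a) \<in> (edges G')\<^sup>*" "(n, b) \<in> (edges G')\<^sup>*" by blast
    then show "\<exists>n\<in>nodes G. (n, a) \<in> (edges G)\<^sup>* \<and> (n, b) \<in> (edges G)\<^sup>*"
      using to_G P by (intro bexI[of _ "if n = q then P else n"] conjI) simp_all
  next
    assume "\<exists>n\<in>nodes G. (n, a) \<in> (edges G)\<^sup>* \<and> (n, b) \<in> (edges G)\<^sup>*"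
    then obtain n where "n \<in> nodes G" "(n, a) \<in> (edges G)\<^sup>*" "(n, b) \<in> (edges G)\<^sup>*" by blast
    then show "\<exists>n\<in>nodes G. (n, a) \<in> (edges G')\<^sup>* \<and> (n, b) \<in> (edges G')\<^sup>*"
      using to_G' q by (intro bexI[of _ "if n = P then q else n"] conjI) simp_all
  qed
qed

lemma COH_G': "COH A lt G' = COH A lt G"
  unfolding COH_def reach_G'_iff ..

section \<open>Weighted abduction\<close>

context
  fixes ic :: "('p, 'v, 'c) gatom \<Rightarrow> real" and w :: "('p, 'v, 'c) axiom \<Rightarrow> nat \<Rightarrow> real"
begin

lemma cost_G: "cost A ic w G R =
  unfactored_cost A ic w G (cost A ic w G) R \<union> (\<lambda>S. Min (cost A ic w G S)) ` {S. (R, S) \<in> factored G}"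
  by (rule cost_unfold[OF pg, unfolded cost_step_unfactored])

lemma cost_G': "cost A ic w G' R =
  unfactored_cost A ic w G' (cost A ic w G') R \<union> (\<lambda>S. Min (cost A ic w G' S)) ` {S. (R, S) \<in> factored G'}"
proof -
  obtain H' where "proof_graph A H' G'" using proof_graph_G' by blast
  then show ?thesis by (rule cost_unfold[unfolded cost_step_unfactored])
qed

text \<open>Costs flow from an atom to its predecessors. A successor of \<open>R\<close> is neither
  \<open>P\<close>, which has no incoming edge, nor \<open>q\<close>, whose only one comes from
  \<open>P\<close>; so the induction never meets the swapped atoms.\<close>

lemma cost_unchanged: "R \<noteq> P \<Longrightarrow> R \<noteq> q \<Longrightarrow> cost A ic w G' R = cost A ic w G R"
proof -
  have "wf ((edges G)\<inverse>)"
    using finite_acyclic_wf_converse[OF generates_finite_edges[OF gen] acyc] .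
  then show "R \<noteq> P \<Longrightarrow> R \<noteq> q \<Longrightarrow> cost A ic w G' R = cost A ic w G R"
  proof (induction R rule: wf_induct_rule)
    case (less R)
    have succ: "cost A ic w G' S = cost A ic w G S" if "(R, S) \<in> edges G" for S
    proof (rule less.IH)
      show "(S, R) \<in> (edges G)\<inverse>" using that by simp
      show "S \<noteq> P" using that no_edge_to_P by blast
      show "S \<noteq> q" using that less.prems(1) edge_to_group[OF q_group] by blast
    qed
    have "{S. (R, S) \<in> factored G'} = {S. (R, S) \<in> factored G}"
      using less.prems unfolding G'_def by auto
    moreover have "(\<lambda>S. Min (cost A ic w G' S)) ` {S. (R, S) \<in> factored G} =
        (\<lambda>S. Min (cost A ic w G S)) ` {S. (R, S) \<in> factored G}"
    proof (rule image_cong)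
      fix S assume "S \<in> {S. (R, S) \<in> factored G}"
      then have "(R, S) \<in> edges G" by (simp add: edges_def)
      then show "Min (cost A ic w G' S) = Min (cost A ic w G S)" by (simp only: succ)
    qed (rule refl)
    moreover have "unfactored_cost A ic w G' (cost A ic w G') R =
        unfactored_cost A ic w G (cost A ic w G) R"
      using succ chained_G' by (rule unfactored_cost_cong)
    ultimately show ?case unfolding cost_G[of R] cost_G'[of R] by (simp only:)
  qed
qed

text \<open>Neither \<open>q\<close> before the swap nor \<open>P\<close> after it is the start of a
  factoring edge, so each passes exactly its unfactored minimum to the other. The two cost sets then
  have the shapes compared in \<open>Min_Un_insert_Min\<close>.\<close>

lemma Min_cost_swap: "Min (cost A ic w G' q) = Min (cost A ic w G P)"
proof -
  let ?c = "cost A ic w G" and ?c' = "cost A ic w G'"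
  let ?u = "unfactored_cost A ic w G ?c"
  let ?m = "(\<lambda>S. Min (?c S)) ` (group - {q})"
  have Pq: "P \<noteq> q" using P_notin_group q_group by auto
  have u': "unfactored_cost A ic w G' ?c' R = ?u R" if "R \<in> insert P group" for R
  proof -
    \<comment> \<open>Without factoring edges, the congruence does not involve the edge from \<open>P\<close> to \<open>q\<close>.\<close>
    let ?G0 = "G\<lparr>factored := {}\<rparr>"
    have e: "(R, S) \<in> edges G \<and> S \<noteq> P \<and> S \<noteq> q" if "(R, S) \<in> edges ?G0" for S
      using that no_edge_to_P group_not_chained[OF q_group] unfolding edges_def by auto
    have "unfactored_cost A ic w G' ?c' R = unfactored_cost A ic w ?G0 ?c R"
      using e cost_unchanged by (intro unfactored_cost_cong) (auto simp: G'_def)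
    then show ?thesis unfolding unfactored_cost_def by simp
  qed
  have "{S. (P, S) \<in> factored G'} = {}" using Pq unfolding G'_def group_def by auto
  then have c'P: "?c' P = ?u P" using cost_G'[of P] u'[of P] by simp
  have fq: "{S. (q, S) \<in> factored G'} = insert P (group - {q})"
    using group_not_factored[OF q_group] Pq unfolding G'_def by auto
  have cq: "?c q = ?u q" using cost_G[of q] group_not_factored[OF q_group] by simp
  have "?c' q = ?u q \<union> (\<lambda>S. Min (?c' S)) ` insert P (group - {q})"
    using cost_G'[of q] u'[of q] q_group unfolding fq by simp
  also have "(\<lambda>S. Min (?c' S)) ` insert P (group - {q}) = insert (Min (?u P)) ?m"
  proof -
    have "(\<lambda>S. Min (?c' S)) ` (group - {q}) = ?m"
    proof (rule image_cong)
      fix S assume "S \<in> group - {q}"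
      then have "S \<noteq> P" "S \<noteq> q" using P_notin_group by auto
      then show "Min (?c' S) = Min (?c S)" by (simp add: cost_unchanged)
    qed simp
    then show ?thesis by (simp only: image_insert c'P)
  qed
  finally have c'q: "?c' q = ?u q \<union> insert (Min (?u P)) ?m" .
  have "?c P = ?u P \<union> (\<lambda>S. Min (?c S)) ` group"
    using cost_G[of P] by (simp add: group_def)
  \<comment> \<open>The contribution of \<open>q\<close> is split off, since \<open>q\<close> is the
    atom that trades places with \<open>P\<close>.\<close>
  also have "(\<lambda>S. Min (?c S)) ` group = (\<lambda>S. Min (?c S)) ` insert q (group - {q})"
    using q_group by (simp add: insert_absorb)
  also have "\<dots> = insert (Min (?u q)) ?m"
    by (simp only: image_insert cq)
  finally have cP: "?c P = ?u P \<union> insert (Min (?u q)) ?m" .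
  have fin: "finite (?u R)" for R
    using finite_unfactored_cost generates_finite_chained[OF gen] by blast
  have ne: "?u P \<noteq> {}" "?u q \<noteq> {}"
    using unfactored_cost_nonempty[OF gen] group_nodes q_group by auto
  have "finite ?m"
    using group_nodes generates_finite_nodes[OF gen] inst
    unfolding abduction_instance_def by (meson finite_Diff finite_imageI finite_subset insert_subset)
  then show ?thesis
    unfolding c'q cP using fin ne by (intro Min_Un_insert_Min)
qed

lemma WA_G': "WA A ic w G' = WA A ic w G"
proof -
  have "WA A ic w G' = Min (cost A ic w G' q) + (\<Sum>a\<in>abduced G - {P}. Min (cost A ic w G' a))"
    using finite_abduced q_notin_abduced unfolding WA_def abduced_G' by simp
  also have "\<dots> = Min (cost A ic w G P) + (\<Sum>a\<in>abduced G - {P}. Min (cost A ic w G a))"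
  proof -
    have "cost A ic w G' a = cost A ic w G a" if "a \<in> abduced G - {P}" for a
      using that q_notin_abduced by (intro cost_unchanged) auto
    then show ?thesis by (simp add: Min_cost_swap)
  qed
  also have "\<dots> = WA A ic w G"
    unfolding WA_def using sum.remove[OF finite_abduced P_abduced] by metis
  finally show ?thesis .
qed

end

end

section \<open>Transfer to the indexed swap\<close>

theorem proposition3:
  fixes A :: "('p, 'v, 'c) abduction"
    and H :: "('p, 'v, 'c) hypothesis"
    and G :: "('p, 'v, 'c) graph"
    and P :: "('p, 'v, 'c) gatom"
    and Q :: "nat \<Rightarrow> ('p, 'v, 'c) gatom"
    and k i :: nat
    and lt :: "('p, 'v, 'c) gatom rel"
    and ic :: "('p, 'v, 'c) gatom \<Rightarrow> real"
    and w :: "('p, 'v, 'c) axiom \<Rightarrow> nat \<Rightarrow> real"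
  assumes "abduction_instance A"
    and "strict_linear_order_on (goal A) lt"
    and "proof_graph A H G"
    and "factoring_only_with_abduced G"
    and "P \<in> abduced G"
    and "bij_betw Q {1..k} {R. (P, R) \<in> factored G}"
    and "i \<in> {1..k}"
  shows "(\<exists>H'. proof_graph A H' (swap G P Q k i) \<and> atoms H' = atoms H) \<and>
    CARD (swap G P Q k i) = CARD G \<and>
    COH A lt (swap G P Q k i) = COH A lt G \<and>
    WA A ic w (swap G P Q k i) = WA A ic w G"
proof -
  have img: "Q ` {1..k} = {R. (P, R) \<in> factored G}" and inj: "inj_on Q {1..k}"
    using assms(6) by (auto simp: bij_betw_def)
  have "(P, Q i) \<in> factored G" using img assms(7) by blast
  then interpret factored_group A H G P "Q i"
    using assms by unfold_locales
  have grp: "group = Q ` {1..k}"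
    unfolding group_def img ..
  \<comment> \<open>By injectivity, omitting the index \<open>i\<close> is the same as omitting the
    atom \<open>Q i\<close>.\<close>
  then have "group - {Q i} = Q ` ({1..k} - {i})"
    using inj_on_image_set_diff[OF inj, of "{1..k}" "{i}"] assms(7) by simp
  then have "{(Q i, Q j) | j. j \<in> {1..k} \<and> j \<noteq> i} = {Q i} \<times> (group - {Q i})"
    by auto
  moreover have "{(P, Q j) | j. j \<in> {1..k}} = {P} \<times> group"
    unfolding grp by auto
  moreover have "insert P group - {Q i} = insert P (group - {Q i})"
    using P_notin_group q_group by auto
  ultimately have "(factored G - {(P, Q j) | j. j \<in> {1..k}}) \<union> {(Q i, P)} \<union>
      {(Q i, Q j) | j. j \<in> {1..k} \<and> j \<noteq> i} =
    (factored G - {P} \<times> group) \<union> {Q i} \<times> (insert P group - {Q i})"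
    by auto
  then have "swap G P Q k i = G'" unfolding swap_def G'_def by simp
  then show ?thesis using proof_graph_G' CARD_G' COH_G' WA_G' by simp
qed

end
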